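(* If $S \subseteq \mathbb{Z}$ is a set of integers with $|S| = 4$, then $d_p(S) \ge \frac{1}{7}$. Furthermore, $d_p(\{0,1,4,6\}) = \frac{1}{7}$, so the set $\{0,1,4,6\}$ achieves the minimum packing density among all sets of four integers.
   Context: For $S \subseteq \mathbb{Z}$ and $a \in \mathbb{Z}$, write $S + a = \{s + a : s \in S\}$. A set $A \subseteq \mathbb{Z}$ is called $S$-packing if for all $a_1, a_2 \in A$ with $a_1 \neq a_2$, the sets $S + a_1$ and $S + a_2$ are disjoint. The upper density of $A \subseteq \mathbb{Z}$ is $\overline{d}(A) = \limsup_{n\to\infty} \frac{|A \cap [-n,n]|}{2n+1}$. The packing density of $S$ is $d_p(S) = \sup\{\overline{d}(A) : A \text{ is } S\text{-packing}\}$. *)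

theory Defs
  imports "HOL-Analysis.Analysis"
begin

definition translate :: "int set \<Rightarrow> int \<Rightarrow> int set" where
  "translate S a = (\<lambda>s. s + a) ` S"

definition packing :: "int set \<Rightarrow> int set \<Rightarrow> bool" where
  "packing S A \<longleftrightarrow>
     (\<forall>a1\<in>A. \<forall>a2\<in>A. a1 \<noteq> a2 \<longrightarrow> disjnt (translate S a1) (translate S a2))"

(* Densities take values in the complete lattice ereal, so that limsup and Sup are unconditional. *)

definition upper_density :: "int set \<Rightarrow> ereal" where
  "upper_density A =
     limsup (\<lambda>n::nat. ereal (real (card (A \<inter> {- int n..int n})) / (2 * real n + 1)))"

definition packing_density :: "int set \<Rightarrow> ereal" where
  "packing_density S = Sup {upper_density A |A. packing S A}"

end

(* Lower bound: a set of four integers has at most six positive differences. Running through the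
   naturals from left to right and choosing every number that is not a chosen number plus such
   a difference, each chosen number accounts for itself and at most six others, so at least a
   seventh of every initial segment is chosen. A reflected copy of the chosen set, pushed beyond
   the largest difference, fills the negative integers.
   Upper bound: the positive differences of {0, 1, 4, 6} are exactly 1, ..., 6, so distinct
   elements of a packing set are at least 7 apart. *)

theory Submission
  imports Defs "HOL-Real_Asymp.Real_Asymp"
begin

text \<open>Differences are kept as naturals so that the greedy recursion can run on
  \<open>nat\<close>.\<close>

definition pos_diffs :: "int set \<Rightarrow> nat set" where
  "pos_diffs S = {d. d > 0 \<and> (\<exists>s\<in>S. \<exists>t\<in>S. int d = s - t)}"

text \<open>A common point \<open>s + a = t + b\<close> of two translates amounts to
  \<open>a - b = t - s\<close>. Exchanging the roles of \<open>a\<close> and \<open>b\<close> flips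
  the sign, so positive differences suffice.\<close>

lemma packing_iff_pos_diffs:
  "packing S A \<longleftrightarrow> (\<forall>a\<in>A. \<forall>b\<in>A. \<forall>d\<in>pos_diffs S. a - b \<noteq> int d)"
proof
  assume A: "packing S A"
  show "\<forall>a\<in>A. \<forall>b\<in>A. \<forall>d\<in>pos_diffs S. a - b \<noteq> int d"
  proof (intro ballI notI)
    fix a b d assume *: "a \<in> A" "b \<in> A" "d \<in> pos_diffs S" "a - b = int d"
    then obtain s t where st: "s \<in> S" "t \<in> S" "int d = s - t" and "d > 0"
      unfolding pos_diffs_def by blast
    then have "a \<noteq> b" using * by auto
    then have "disjnt (translate S a) (translate S b)"
      using A * unfolding packing_def by blast
    moreover have "t + a \<in> translate S a" "s + b \<in> translate S b"
      using st unfolding translate_def by auto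
    moreover have "t + a = s + b" using st * by simp
    ultimately show False unfolding disjnt_iff by metis
  qed
next
  assume A: "\<forall>a\<in>A. \<forall>b\<in>A. \<forall>d\<in>pos_diffs S. a - b \<noteq> int d"
  have no: False if "a \<in> A" "b \<in> A" "s \<in> S" "t \<in> S" "s + a = t + b" "a > b" for a b s t
  proof -
    have "nat (a - b) \<in> pos_diffs S"
      unfolding pos_diffs_def using that(3-6)
      by (intro CollectI conjI bexI[of _ t] bexI[of _ s]) auto
    moreover have "a - b = int (nat (a - b))" using \<open>a > b\<close> by simp
    ultimately show False using A that by blast
  qed
  show "packing S A"
    unfolding packing_def disjnt_iff translate_def
  proof (intro ballI impI allI notI, elim conjE imageE)
    fix a b x s t
    assume "a \<in> A" "b \<in> A" "a \<noteq> b" "x = s + a" "x = t + b" "s \<in> S" "t \<in> S"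
    then show False using no[of a b s t] no[of b a t s] by (cases "a > b") auto
  qed
qed

text \<open>Each positive difference is the spread \<open>Max T - Min T\<close> of a two-element
  subset \<open>T\<close>, so the pairs map onto a superset of the differences.\<close>

lemma pos_diffs_bound:
  assumes "finite S"
  shows "finite (pos_diffs S)" and "card (pos_diffs S) \<le> card S choose 2"
proof -
  let ?P = "{T. T \<subseteq> S \<and> card T = 2}"
  have sub: "pos_diffs S \<subseteq> (\<lambda>T. nat (Max T - Min T)) ` ?P"
  proof
    fix d assume "d \<in> pos_diffs S"
    then obtain s t where st: "d > 0" "s \<in> S" "t \<in> S" "int d = s - t"
      unfolding pos_diffs_def by blast
    then have "t < s" by linarith
    then have "d = nat (Max {s, t} - Min {s, t})" using st by simp
    then show "d \<in> (\<lambda>T. nat (Max T - Min T)) ` ?P"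
      using st \<open>t < s\<close> by (intro image_eqI[of _ _ "{s, t}"]) auto
  qed
  have fin: "finite ?P" using assms by simp
  show "finite (pos_diffs S)" using sub fin finite_surj by blast
  show "card (pos_diffs S) \<le> card S choose 2"
    using surj_card_le[OF fin sub] n_subsets[OF assms, of 2] by simp
qed

text \<open>With \<open>0 \<notin> D\<close>, membership of \<open>n\<close> depends only on the
  smaller numbers \<open>n - d\<close>, so well-founded recursion along \<open><\<close> defines the
  set.\<close>

lemma greedy_set_exists:
  fixes D :: "nat set"
  assumes "0 \<notin> D"
  obtains A where "\<And>n. n \<in> A \<longleftrightarrow> (\<forall>d\<in>D. d \<le> n \<longrightarrow> n - d \<notin> A)"
proof -
  define F where "F = (\<lambda>f n. \<forall>d\<in>D. d \<le> n \<longrightarrow> \<not> f (n - d))"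
  define g where "g = wfrec less_than F"
  have "adm_wf less_than F"
    unfolding adm_wf_def F_def
  proof (intro allI impI)
    fix f h :: "nat \<Rightarrow> bool" and n :: nat
    assume eq: "\<forall>z. (z, n) \<in> less_than \<longrightarrow> f z = h z"
    have "f (n - d) = h (n - d)" if "d \<in> D" "d \<le> n" for d
    proof -
      have "d > 0" using that assms by (cases d) auto
      then show ?thesis using eq that by simp
    qed
    then show "(\<forall>d\<in>D. d \<le> n \<longrightarrow> \<not> f (n - d)) = (\<forall>d\<in>D. d \<le> n \<longrightarrow> \<not> h (n - d))"
      by blast
  qed
  then have g: "g n = F g n" for n
    unfolding g_def by (rule wfrec_fixpoint[OF wf_less_than, THEN fun_cong])
  have "n \<in> Collect g \<longleftrightarrow> (\<forall>d\<in>D. d \<le> n \<longrightarrow> n - d \<notin> Collect g)" for n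
    unfolding mem_Collect_eq by (rule g[unfolded F_def])
  then show thesis by (rule that)
qed

text \<open>A number outside \<open>A\<close> was rejected because of some \<open>x - d\<close> in
  \<open>A\<close>. Hence the shifts of \<open>A \<inter> {..n}\<close> by 0 and by the elements of
  \<open>D\<close> cover \<open>{..n}\<close>.\<close>

lemma greedy_set_dense:
  fixes D A :: "nat set"
  assumes "finite D" and A: "\<And>n. n \<in> A \<longleftrightarrow> (\<forall>d\<in>D. d \<le> n \<longrightarrow> n - d \<notin> A)"
  shows "n + 1 \<le> (card D + 1) * card (A \<inter> {..n})"
proof -
  let ?P = "(A \<inter> {..n}) \<times> insert 0 D"
  have "{..n} \<subseteq> (\<lambda>(a, d). a + d) ` ?P"
  proof
    fix x assume x: "x \<in> {..n}"
    show "x \<in> (\<lambda>(a, d). a + d) ` ?P"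
    proof (cases "x \<in> A")
      case True
      then show ?thesis using x by (intro image_eqI[of _ _ "(x, 0)"]) auto
    next
      case False
      then obtain d where "d \<in> D" "d \<le> x" "x - d \<in> A" using A[of x] by blast
      then show ?thesis using x by (intro image_eqI[of _ _ "(x - d, d)"]) auto
    qed
  qed
  then have "card {..n} \<le> card ?P" by (intro surj_card_le) (use assms(1) in auto)
  also have "\<dots> = card (A \<inter> {..n}) * card (insert 0 D)" by (rule card_cartesian_product)
  also have "\<dots> \<le> card (A \<inter> {..n}) * (card D + 1)"
    using card_insert_le_m1[of "card D + 1" D 0] by (intro mult_left_mono) auto
  finally show ?thesis by (simp add: mult.commute)
qed

lemma packing_density_ge:
  assumes "finite S"
  shows "packing_density S \<ge> ereal (1 / real ((card S choose 2) + 1))"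
proof -
  let ?D = "pos_diffs S"
  define k where "k = real ((card S choose 2) + 1)"
  have "k > 0" by (simp add: k_def)
  have finD: "finite ?D" using pos_diffs_bound[OF assms] by simp
  have "0 \<notin> ?D" by (simp add: pos_diffs_def)
  then obtain A where A: "\<And>n. n \<in> A \<longleftrightarrow> (\<forall>d\<in>?D. d \<le> n \<longrightarrow> n - d \<notin> A)"
    by (rule greedy_set_exists) blast
  \<comment> \<open>Inserting 0 forces \<open>M > 0\<close> even when there are no positive
    differences.\<close>
  obtain M where M: "\<And>d. d \<in> ?D \<Longrightarrow> d < M" and "M > 0"
    using finite_nat_set_iff_bounded[of "insert 0 ?D"] finD by auto
  \<comment> \<open>The shift by \<open>M\<close> leaves a distance of at least \<open>M\<close>
    between the two halves of \<open>B\<close>, more than any forbidden difference.\<close>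
  define R where "R = (\<lambda>x. - int x - int M)"
  define B where "B = int ` A \<union> R ` A"
  have A_diff: "int x - int y \<noteq> int d" if "x \<in> A" "y \<in> A" "d \<in> ?D" for x y d
  proof
    assume "int x - int y = int d"
    then have "x - d = y" "d \<le> x" by linarith+
    then show False using A[of x] that by blast
  qed
  have "packing S B"
    unfolding packing_iff_pos_diffs
  proof (intro ballI)
    fix a b d assume "a \<in> B" "b \<in> B" and d: "d \<in> ?D"
    then consider x y where "a = int x" "b = int y" "x \<in> A" "y \<in> A"
      | x y where "a = R x" "b = R y" "x \<in> A" "y \<in> A"
      | x y where "a = int x" "b = R y"
      | x y where "a = R x" "b = int y"
      unfolding B_def by blast
    then show "a - b \<noteq> int d"
    proof cases
      case 1
      then show ?thesis using A_diff d by blast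
    next
      case (2 x y)
      \<comment> \<open>Reflection reverses differences:
        \<open>R x - R y = int y - int x\<close>.\<close>
      then show ?thesis using A_diff[of y x d] d by (simp add: R_def)
    next
      case 3
      then show ?thesis using M[OF d] by (simp add: R_def)
    next
      case 4
      then show ?thesis using M[OF d] by (simp add: R_def)
    qed
  qed
  have dense: "real n + 1 \<le> k * real (card (A \<inter> {..n}))" for n
  proof -
    have "n + 1 \<le> (card ?D + 1) * card (A \<inter> {..n})"
      by (rule greedy_set_dense[OF finD A])
    also have "\<dots> \<le> ((card S choose 2) + 1) * card (A \<inter> {..n})"
      using pos_diffs_bound(2)[OF assms] by (intro mult_right_mono) auto
    finally have "real (n + 1) \<le> real (((card S choose 2) + 1) * card (A \<inter> {..n}))"
      by (rule of_nat_mono)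
    then show ?thesis by (simp add: k_def algebra_simps)
  qed
  \<comment> \<open>\<open>R x \<ge> - int n\<close> means \<open>x \<le> n - M\<close>, so the
    negative half contributes \<open>A \<inter> {..n - M}\<close>. The two density estimates add up
    to (n + 1) + (n - M + 1); for \<open>n \<ge> M\<close> the subtraction on \<open>nat\<close> is
    exact.\<close>
  have lower: "(2 * real n + 2 - real M) / k / (2 * real n + 1)
      \<le> real (card (B \<inter> {- int n..int n})) / (2 * real n + 1)" if "n \<ge> M" for n
  proof -
    have "card (A \<inter> {..n}) + card (A \<inter> {..n - M})
        = card (int ` (A \<inter> {..n})) + card (R ` (A \<inter> {..n - M}))"
      by (simp add: card_image inj_on_def R_def)
    also have "\<dots> = card (int ` (A \<inter> {..n}) \<union> R ` (A \<inter> {..n - M}))"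
      \<comment> \<open>\<open>M > 0\<close> makes all values of \<open>R\<close> negative, hence
        disjoint from the image of \<open>int\<close>.\<close>
      using \<open>M > 0\<close> by (intro card_Un_disjoint[symmetric]) (auto simp: R_def)
    also have "\<dots> \<le> card (B \<inter> {- int n..int n})"
      by (intro card_mono) (use that in \<open>auto simp: B_def R_def\<close>)
    finally have "real (card (A \<inter> {..n})) + real (card (A \<inter> {..n - M}))
        \<le> real (card (B \<inter> {- int n..int n}))" by linarith
    then have "k * (real (card (A \<inter> {..n})) + real (card (A \<inter> {..n - M})))
        \<le> k * real (card (B \<inter> {- int n..int n}))"
      using \<open>k > 0\<close> by (intro mult_left_mono) auto
    then have "2 * real n + 2 - real M \<le> k * real (card (B \<inter> {- int n..int n}))"
      using dense[of n] dense[of "n - M"] that by (simp add: distrib_left of_nat_diff)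
    then show ?thesis
      using \<open>k > 0\<close> by (intro divide_right_mono) (simp_all add: pos_divide_le_eq mult.commute)
  qed
  have "((\<lambda>n. (2 * real n + 2 - real M) / k / (2 * real n + 1)) \<longlongrightarrow> inverse k) sequentially"
    using \<open>k > 0\<close> by real_asymp
  then have "((\<lambda>n. ereal ((2 * real n + 2 - real M) / k / (2 * real n + 1)))
      \<longlongrightarrow> ereal (1 / k)) sequentially"
    unfolding inverse_eq_divide by (rule tendsto_ereal)
  then have "ereal (1 / k)
      = limsup (\<lambda>n. ereal ((2 * real n + 2 - real M) / k / (2 * real n + 1)))"
    by (rule lim_imp_Limsup[OF trivial_limit_sequentially, symmetric])
  also have "\<dots> \<le> upper_density B"
    unfolding upper_density_def
    by (intro Limsup_mono eventually_mono[OF eventually_ge_at_top[of M]])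
      (use lower in simp)
  also have "\<dots> \<le> packing_density S"
    unfolding packing_density_def using \<open>packing S B\<close> by (intro Sup_upper) blast
  finally show ?thesis by (simp add: k_def)
qed

text \<open>Cut the integers from -n onwards into blocks of length \<open>m\<close>. The gap allows
  at most one element of \<open>A\<close> per block, and [-n, n] meets
  \<open>2 * n div m + 1\<close> blocks.\<close>

lemma upper_density_le_of_gap:
  assumes "m > 0" and gap: "\<And>a b. a \<in> A \<Longrightarrow> b \<in> A \<Longrightarrow> b < a \<Longrightarrow> int m \<le> a - b"
  shows "upper_density A \<le> ereal (1 / real m)"
proof -
  have count: "real (card (A \<inter> {- int n..int n})) \<le> 2 * real n / real m + 1" for n
  proof -
    let ?f = "\<lambda>x. nat ((x + int n) div int m)"
    \<comment> \<open>\<open>?f\<close> is the block index. Moving up by \<open>m\<close> raises it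
      by exactly one, and \<open>- int n \<le> y\<close> keeps it nonnegative, so that
      \<open>nat\<close> does not collapse values.\<close>
    have "?f y < ?f x" if "x \<in> A" "y \<in> A" "y < x" "- int n \<le> y" for x y
    proof -
      have "(y + int n) div int m + 1 = (y + int n + int m) div int m"
        using \<open>m > 0\<close> by simp
      also have "\<dots> \<le> (x + int n) div int m"
        using gap[of x y] that \<open>m > 0\<close> by (intro zdiv_mono1) auto
      finally show ?thesis
        using that \<open>m > 0\<close> pos_imp_zdiv_nonneg_iff[of "int m" "y + int n"] by auto
    qed
    then have "inj_on ?f (A \<inter> {- int n..int n})"
      by (intro linorder_inj_onI') fastforce
    moreover have "?f ` (A \<inter> {- int n..int n}) \<subseteq> {..(2 * n) div m}"
    proof clarsimp
      fix x assume "x \<le> int n"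
      then have "(x + int n) div int m \<le> int (2 * n) div int m"
        using \<open>m > 0\<close> by (intro zdiv_mono1) auto
      then show "nat ((x + int n) div int m) \<le> 2 * n div m"
        by (metis nat_le_iff zdiv_int)
    qed
    ultimately have "card (A \<inter> {- int n..int n}) \<le> 2 * n div m + 1"
      using card_inj_on_le[of ?f "A \<inter> {- int n..int n}" "{..(2 * n) div m}"] by simp
    then show ?thesis using of_nat_div_le_of_nat[where ?'a = real, of "2 * n" m] by simp
  qed
  have "((\<lambda>n. (2 * real n / real m + 1) / (2 * real n + 1)) \<longlongrightarrow> inverse (real m)) sequentially"
    using \<open>m > 0\<close> by real_asymp
  then have "((\<lambda>n. ereal ((2 * real n / real m + 1) / (2 * real n + 1)))
      \<longlongrightarrow> ereal (1 / real m)) sequentially"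
    unfolding inverse_eq_divide by (rule tendsto_ereal)
  then have "limsup (\<lambda>n. ereal ((2 * real n / real m + 1) / (2 * real n + 1)))
      = ereal (1 / real m)"
    by (rule lim_imp_Limsup[OF trivial_limit_sequentially])
  moreover have "upper_density A
      \<le> limsup (\<lambda>n. ereal ((2 * real n / real m + 1) / (2 * real n + 1)))"
    unfolding upper_density_def
    by (intro Limsup_mono always_eventually allI) (auto intro!: divide_right_mono count)
  ultimately show ?thesis by simp
qed

text \<open>{0, 1, 4, 6} is a perfect Golomb ruler, so all gaps below 7 are forbidden.\<close>

lemma packing_density_0146_le: "packing_density {0, 1, 4, 6} \<le> ereal (1 / 7)"
  unfolding packing_density_def
proof (rule Sup_least, clarify)
  fix A assume A: "packing {0, 1, 4, 6} A"
  have diffs: "d \<in> pos_diffs {0, 1, 4, 6}" if "0 < d" "d < 7" for d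
  proof -
    have "d \<in> {1, 2, 3, 4, 5, 6}" using that by auto
    \<comment> \<open>1 = 1 - 0, 2 = 6 - 4, 3 = 4 - 1, 4 = 4 - 0, 5 = 6 - 1, 6 = 6 - 0.\<close>
    then show ?thesis by (auto simp: pos_diffs_def)
  qed
  have "int 7 \<le> a - b" if "a \<in> A" "b \<in> A" "b < a" for a b
  proof (rule ccontr)
    assume "\<not> int 7 \<le> a - b"
    then have "nat (a - b) \<in> pos_diffs {0, 1, 4, 6}" using that by (intro diffs) auto
    then show False using A that unfolding packing_iff_pos_diffs by force
  qed
  then show "upper_density A \<le> ereal (1 / 7)"
    using upper_density_le_of_gap[of 7 A] by simp
qed

theorem mainTheorem1:
  shows "(\<forall>S::int set. card S = 4 \<longrightarrow> packing_density S \<ge> ereal (1 / 7)) \<and>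
         packing_density {0, 1, 4, 6} = ereal (1 / 7) \<and>
         is_arg_min packing_density (\<lambda>S::int set. card S = 4) {0, 1, 4, 6}"
proof -
  have ge: "packing_density S \<ge> ereal (1 / 7)" if "card S = 4" for S :: "int set"
  proof -
    \<comment> \<open>Infinite sets have \<open>card\<close> 0 by default, so cardinality 4 forces
      finiteness.\<close>
    have "finite S" using that by (metis card.infinite zero_neq_numeral)
    moreover have "real ((card S choose 2) + 1) = 7" using that by (simp add: choose_two)
    ultimately show ?thesis using packing_density_ge[of S] by simp
  qed
  have "card {0, 1, 4, 6 :: int} = 4" by simp
  moreover have eq: "packing_density {0, 1, 4, 6} = ereal (1 / 7)"
    by (rule antisym[OF packing_density_0146_le ge]) simp
  ultimately show ?thesis
    using ge unfolding is_arg_min_def eq by (auto simp: not_less)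
qed

end
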